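(* Let $d\geq1$ and $n\geq2$ be integers, let $p\in(0,1)$ with $p>1/n^d$, and let $F\subseteq[0,1]^d$ be the fractal percolation with parameters $n$ and $p$. Then, conditioned on $F$ being non-empty, almost surely $F$ cannot be embedded in any lower dimensional Euclidean space via a bi-Lipschitz map, i.e. there does not exist a bi-Lipschitz map $\phi:F\to\mathbb{R}^{d-1}$.
   Context: Fractal (Mandelbrot) percolation: start with the unit cube $[0,1]^d$. Divide it into the mesh of $n^d$ compact subcubes of side length $1/n$, and keep each subcube independently with probability $p$ (discarding it otherwise); let $Q_1$ be the union of the kept cubes. Repeat the process independently inside each surviving cube (dividing it into $n^d$ compact subcubes of side $1/n^2$, each kept independently with probability $p$) to get $Q_2\subseteq Q_1$, and so on, giving a decreasing sequence of compact sets $Q_k$, a union of cubes of side $n^{-k}$. Then $F=\bigcap_{k\in\mathbb{N}}Q_k$. A map $\phi:F\to\mathbb{R}^{m}$ is bi-Lipschitz if there are constants $0<a\leq b<\infty$ with $a|x-y|\leq|\phi(x)-\phi(y)|\leq b|x-y|$ for all $x,y\in F$. *)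

theory Defs
  imports "HOL-Probability.Probability"
begin

text \<open>
  The mesh cubes of side \<open>n\<^sup>-\<^sup>k\<close> in the unit cube are addressed by their level \<open>k\<close> and an
  index vector \<open>j\<close> with entries below \<open>n ^ k\<close>.
\<close>

definition mesh_index :: "nat \<Rightarrow> nat \<Rightarrow> (nat ^ 'd::finite) set" where
  "mesh_index n k = {j. \<forall>i. j $ i < n ^ k}"

definition mesh_cube :: "nat \<Rightarrow> nat \<Rightarrow> nat ^ 'd::finite \<Rightarrow> (real ^ 'd) set" where
  "mesh_cube n k j =
     cbox (\<chi> i. real (j $ i) / real n ^ k) (\<chi> i. (real (j $ i) + 1) / real n ^ k)"

text \<open>
  The retention decisions are attached to all mesh cubes of level at least 1, including those inside
  discarded cubes; the latter decisions are never consulted in \<open>surviving\<close>. Levels below 1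
  and index vectors outside \<open>mesh_index\<close> are not constrained and not consulted.
\<close>

locale fractal_percolation = prob_space M
  for M :: "'w measure" +
  fixes n :: nat and p :: real and keep :: "nat \<times> (nat ^ 'd::finite) \<Rightarrow> 'w \<Rightarrow> bool"
  assumes indep_keep: "indep_vars (\<lambda>_. count_space UNIV) keep (SIGMA k:{1..}. mesh_index n k)"
    and prob_keep: "\<And>k j. 1 \<le> k \<Longrightarrow> j \<in> mesh_index n k \<Longrightarrow>
                      prob {\<omega> \<in> space M. keep (k, j) \<omega>} = p"

text \<open>
  The cube of level \<open>k + 1\<close> with index \<open>j\<close> is one of the \<open>n ^ d\<close> subcubes of the cube of level \<open>k\<close>
  with index \<open>j div n\<close> (entrywise).
\<close>

primrec surviving ::
  "nat \<Rightarrow> (nat \<times> (nat ^ 'd::finite) \<Rightarrow> 'w \<Rightarrow> bool) \<Rightarrow> 'w \<Rightarrow> nat \<Rightarrow> (nat ^ 'd) set" where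
  "surviving n keep \<omega> 0 = mesh_index n 0"
| "surviving n keep \<omega> (Suc k) =
     {j \<in> mesh_index n (Suc k). (\<chi> i. j $ i div n) \<in> surviving n keep \<omega> k \<and> keep (Suc k, j) \<omega>}"

definition percolation_stage ::
  "nat \<Rightarrow> (nat \<times> (nat ^ 'd::finite) \<Rightarrow> 'w \<Rightarrow> bool) \<Rightarrow> nat \<Rightarrow> 'w \<Rightarrow> (real ^ 'd) set" where
  "percolation_stage n keep k \<omega> = (\<Union>j\<in>surviving n keep \<omega> k. mesh_cube n k j)"

definition percolation_set ::
  "nat \<Rightarrow> (nat \<times> (nat ^ 'd::finite) \<Rightarrow> 'w \<Rightarrow> bool) \<Rightarrow> 'w \<Rightarrow> (real ^ 'd) set" where
  "percolation_set n keep \<omega> = (\<Inter>k. percolation_stage n keep k \<omega>)"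

text \<open>
  The target \<open>\<real>\<^sup>m\<close> is the carrier of \<open>Euclidean_space m\<close> (sequences vanishing from index \<open>m\<close> on) rather
  than a vector type, since \<open>m = 0\<close> has to be allowed.
\<close>

definition bi_lipschitz_into :: "nat \<Rightarrow> 'a::metric_space set \<Rightarrow> ('a \<Rightarrow> nat \<Rightarrow> real) \<Rightarrow> bool" where
  "bi_lipschitz_into m S \<phi> \<longleftrightarrow>
     \<phi> \<in> S \<rightarrow> topspace (Euclidean_space m) \<and>
     (\<exists>a b. 0 < a \<and> a \<le> b \<and>
        (\<forall>x\<in>S. \<forall>y\<in>S. a * dist x y \<le> L2_set (\<lambda>i. \<phi> x i - \<phi> y i) {..<m} \<and>
                      L2_set (\<lambda>i. \<phi> x i - \<phi> y i) {..<m} \<le> b * dist x y))"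

end

theory Submission
  imports Defs
begin

text \<open>
  The set \<open>F\<close> contains approximate copies of arbitrarily fine full grids, and such copies do not fit
  into a Euclidean space of lower dimension.

  \<^bold>\<open>Grids are an obstruction.\<close> Suppose that for every \<open>T\<close> the set \<open>F\<close> meets all \<open>T\<^sup>d\<close> cells of some
  axis-parallel grid, whose position and cell side \<open>\<delta>\<close> may depend on \<open>T\<close>. Choosing a point of \<open>F\<close> in
  every second cell in each direction gives about \<open>T\<^sup>d\<close> points at mutual distance at least \<open>\<delta>\<close> and
  at most of order \<open>T * \<delta>\<close>. A bi-Lipschitz map preserves both bounds up to constants, but in dimension
  \<open>d - 1\<close> only of order \<open>T\<close> to the power \<open>d - 1\<close> such points can be placed, which is impossible for
  large \<open>T\<close> (\<open>coarse_grids_imp_no_bi_lipschitz\<close>).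

  \<^bold>\<open>Grids occur almost surely on survival.\<close> It suffices to find a retained cube \<open>Q\<close> all of whose
  subcubes \<open>l\<close> generations below meet \<open>F\<close>; call the realization rich if there is one. Let \<open>s\<close> be
  the probability that \<open>F\<close> is non-empty, \<open>g\<close> the probability of being rich, and \<open>N = n\<^sup>d\<close>. The
  \<open>N\<close> subtrees hanging off the first generation are independent copies of the whole tree, whence
  \<open>s = 1 - (1 - p * s) ^ N\<close>. A realization is rich as soon as one retained first-generation subtree
  is, whence \<open>1 - (1 - p * g) ^ N \<le> g\<close>. Since \<open>p * N > 1\<close> the survival probability \<open>s\<close> is positive,
  and then so is \<open>g\<close>, because with positive probability already the \<open>N ^ l\<close> cubes of generation \<open>l\<close> are
  all retained and survive. By strict concavity of \<open>1 - (1 - p * x) ^ N\<close> in \<open>x\<close> these relations force \<open>g \<ge> s\<close>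
  (\<open>survival_fixed_point_unique\<close>). As rich realizations have non-empty \<open>F\<close>, the two events agree up
  to a null set (\<open>AE_coarse_grid\<close>).

  The probabilistic part takes place on the canonical space of all retention patterns with the product
  measure, where a subtree is again a point of the same space; \<open>distr_keep\<close> transports the result to
  an arbitrary percolation.
\<close>

section \<open>Grids in a set obstruct bi-Lipschitz maps to lower dimension\<close>

text \<open>
  The set meets every cell of some \<open>T \<times> \<dots> \<times> T\<close> grid of cubes. The corner \<open>x\<close> and the side \<open>\<delta>\<close> are free, so
  the property passes from a set to its translated and rescaled copies.
\<close>
definition coarse_grid :: "nat \<Rightarrow> (real ^ 'd::finite) set \<Rightarrow> bool" where
  "coarse_grid T S \<longleftrightarrow>
     (\<exists>x \<delta>. 0 < \<delta> \<and>
        (\<forall>v :: nat ^ 'd. (\<forall>i. v $ i < T) \<longrightarrow>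
           (\<exists>y\<in>S. \<forall>i. x $ i + \<delta> * real (v $ i) \<le> y $ i \<and> y $ i \<le> x $ i + \<delta> * (real (v $ i) + 1))))"

lemma finite_box_nat_vec: "finite {v :: nat ^ 'd::finite. \<forall>i. v $ i < m}"
  and card_box_nat_vec: "card {v :: nat ^ 'd::finite. \<forall>i. v $ i < m} = m ^ CARD('d)"
proof -
  have "bij_betw vec_nth {v :: nat ^ 'd. \<forall>i. v $ i < m} (PiE UNIV (\<lambda>_. {..<m}))"
    by (rule bij_betwI[where g = vec_lambda]) (auto simp: vec_lambda_inverse)
  then show "finite {v :: nat ^ 'd. \<forall>i. v $ i < m}"
    and "card {v :: nat ^ 'd. \<forall>i. v $ i < m} = m ^ CARD('d)"
    by (auto simp: bij_betw_finite finite_PiE bij_betw_same_card card_PiE)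
qed

text \<open>
  Cut space into half-open cubes of side \<open>s\<close>. Points in one cube are closer than \<open>(m + 1) * s\<close>, hence
  the cubes separate the points, while only \<open>2 * R + 1\<close> slabs in each direction come near \<open>f w0\<close>. The
  factor \<open>m + 1\<close> in place of \<open>m\<close> keeps the separation positive when \<open>m = 0\<close>.
\<close>
lemma packing_bound:
  fixes f :: "'a \<Rightarrow> nat \<Rightarrow> real"
  assumes "0 < s"
    and sep: "\<And>v w. v \<in> W \<Longrightarrow> w \<in> W \<Longrightarrow> v \<noteq> w \<Longrightarrow>
                real (Suc m) * s \<le> L2_set (\<lambda>i. f v i - f w i) {..<m}"
    and near: "\<And>w. w \<in> W \<Longrightarrow> L2_set (\<lambda>i. f w i - f w0 i) {..<m} \<le> real R * s"
  shows "card W \<le> (2 * R + 1) ^ m"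
proof -
  define h where "h w = (\<lambda>i\<in>{..<m}. \<lfloor>(f w i - f w0 i) / s\<rfloor>)" for w
  have "h w \<in> PiE {..<m} (\<lambda>_. {- int R..int R})" if "w \<in> W" for w
  proof -
    have "\<lfloor>(f w i - f w0 i) / s\<rfloor> \<in> {- int R..int R}" if "i < m" for i
    proof -
      have "L2_set (\<lambda>i. \<bar>f w i - f w0 i\<bar>) {..<m} = L2_set (\<lambda>i. f w i - f w0 i) {..<m}"
        by (simp add: L2_set_def)
      then have "\<bar>f w i - f w0 i\<bar> \<le> real R * s"
        using member_le_L2_set[of "{..<m}" i "\<lambda>i. \<bar>f w i - f w0 i\<bar>"] near[OF \<open>w \<in> W\<close>] that
        by simp
      then have "- real R \<le> (f w i - f w0 i) / s" "(f w i - f w0 i) / s \<le> real R"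
        using \<open>0 < s\<close> by (auto simp: field_simps abs_le_iff)
      then show ?thesis
        by (auto simp: le_floor_iff) linarith
    qed
    then show ?thesis
      by (auto simp: h_def)
  qed
  moreover have "inj_on h W"
  proof (rule inj_onI, rule ccontr)
    fix v w assume vw: "v \<in> W" "w \<in> W" "h v = h w" "v \<noteq> w"
    have "\<bar>f v i - f w i\<bar> \<le> s" if "i < m" for i
    proof -
      have "\<lfloor>(f v i - f w0 i) / s\<rfloor> = \<lfloor>(f w i - f w0 i) / s\<rfloor>"
        using fun_cong[OF vw(3), of i] that by (simp add: h_def)
      then have "\<bar>(f v i - f w0 i) / s - (f w i - f w0 i) / s\<bar> < 1"
        by linarith
      also have "(f v i - f w0 i) / s - (f w i - f w0 i) / s = (f v i - f w i) / s"
        by (simp add: diff_divide_distrib)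
      finally show ?thesis
        using \<open>0 < s\<close> by (simp add: abs_divide)
    qed
    then have "(\<Sum>i<m. \<bar>f v i - f w i\<bar>) \<le> real m * s"
      using sum_mono[of "{..<m}" "\<lambda>i. \<bar>f v i - f w i\<bar>" "\<lambda>_. s"] by simp
    then have "L2_set (\<lambda>i. f v i - f w i) {..<m} < real (Suc m) * s"
      using L2_set_le_sum_abs[of "\<lambda>i. f v i - f w i" "{..<m}"] \<open>0 < s\<close>
      by (simp add: algebra_simps)
    then show False
      using sep[OF vw(1,2,4)] by simp
  qed
  ultimately have "card W \<le> card (PiE {..<m} (\<lambda>_. {- int R..int R}))"
    by (intro card_inj_on_le[of h]) (auto intro!: finite_PiE)
  then show ?thesis
    by (simp add: card_PiE nat_add_distrib nat_mult_distrib)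
qed

text \<open>
  Images of the points in the \<open>T\<^sup>d\<close> even cells of a grid would satisfy \<open>packing_bound\<close> with \<open>R\<close>
  proportional to \<open>T\<close>, bounding \<open>T\<^sup>d\<close> by a multiple of the power \<open>d - 1\<close> of \<open>T\<close>.
\<close>
lemma coarse_grids_imp_no_bi_lipschitz:
  fixes S :: "(real ^ 'd::finite) set"
  assumes grids: "\<And>T. coarse_grid T S"
  shows "\<not> bi_lipschitz_into (CARD('d) - 1) S \<phi>"
proof
  let ?m = "CARD('d) - 1"
  have card_d: "CARD('d) = Suc ?m"
    using zero_less_card_finite[where 'a = 'd] by simp
  assume "bi_lipschitz_into ?m S \<phi>"
  then obtain a b where "0 < a" "a \<le> b"
    and lower: "\<And>x y. x \<in> S \<Longrightarrow> y \<in> S \<Longrightarrow> a * dist x y \<le> L2_set (\<lambda>i. \<phi> x i - \<phi> y i) {..<?m}"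
    and upper: "\<And>x y. x \<in> S \<Longrightarrow> y \<in> S \<Longrightarrow> L2_set (\<lambda>i. \<phi> x i - \<phi> y i) {..<?m} \<le> b * dist x y"
    unfolding bi_lipschitz_into_def by blast
  obtain Q :: nat where Q: "2 * b * real CARD('d) * real CARD('d) / a \<le> real Q"
    using real_arch_simple by blast
  \<comment> \<open>The Lipschitz constants enter only through \<open>Q\<close>, so \<open>T\<close> can be taken beyond the bound they allow.\<close>
  define T where "T = Suc ((2 * Q + 1) ^ ?m)"
  obtain x \<delta> where "0 < \<delta>"
    and "\<forall>v :: nat ^ 'd. (\<forall>i. v $ i < 2 * T) \<longrightarrow>
           (\<exists>y\<in>S. \<forall>i. x $ i + \<delta> * real (v $ i) \<le> y $ i \<and> y $ i \<le> x $ i + \<delta> * (real (v $ i) + 1))"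
    using grids[of "2 * T"] unfolding coarse_grid_def by blast
  then obtain y where y: "\<And>v :: nat ^ 'd. \<forall>i. v $ i < 2 * T \<Longrightarrow> y v \<in> S \<and>
       (\<forall>i. x $ i + \<delta> * real (v $ i) \<le> y v $ i \<and> y v $ i \<le> x $ i + \<delta> * (real (v $ i) + 1))"
    by metis
  \<comment> \<open>Only cells with even indices are used: distinct ones then leave a gap of at least \<open>\<delta>\<close>.\<close>
  define W where "W = {w :: nat ^ 'd. \<forall>i. w $ i < T}"
  define z where "z w = y (\<chi> i. 2 * w $ i)" for w :: "nat ^ 'd"
  have zS: "z w \<in> S"
    and zlo: "x $ i + \<delta> * (2 * real (w $ i)) \<le> z w $ i"
    and zhi: "z w $ i \<le> x $ i + \<delta> * (2 * real (w $ i) + 1)" if "w \<in> W" for w i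
    using y[of "\<chi> i. 2 * w $ i"] that by (auto simp: z_def W_def)
  have gap: "\<delta> \<le> dist (z v) (z w)" if "v \<in> W" "w \<in> W" "v $ i < w $ i" for v w i
  proof -
    have "\<delta> * (2 * real (v $ i) + 2) \<le> \<delta> * (2 * real (w $ i))"
      using that(3) \<open>0 < \<delta>\<close> by (intro mult_left_mono) auto
    then have "\<delta> \<le> z w $ i - z v $ i"
      using zhi[OF that(1), of i] zlo[OF that(2), of i] by (simp add: algebra_simps)
    also have "\<dots> \<le> dist (z v) (z w)"
      using dist_vec_nth_le[of "z v" i "z w"] by (simp add: dist_real_def)
    finally show ?thesis .
  qed
  have sep: "\<delta> \<le> dist (z v) (z w)" if "v \<in> W" "w \<in> W" "v \<noteq> w" for v w
  proof -
    obtain i where "v $ i < w $ i \<or> w $ i < v $ i"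
      using \<open>v \<noteq> w\<close> by (auto simp: vec_eq_iff neq_iff)
    then show ?thesis
      using gap[of v w i] gap[of w v i] that by (auto simp: dist_commute)
  qed
  have diam: "dist (z v) (z w) \<le> real CARD('d) * (2 * real T * \<delta>)" if "v \<in> W" "w \<in> W" for v w
  proof -
    have "\<bar>z v $ i - z w $ i\<bar> \<le> 2 * real T * \<delta>" for i
    proof -
      have "x $ i \<le> z u $ i \<and> z u $ i \<le> x $ i + 2 * real T * \<delta>" if "u \<in> W" for u
      proof -
        have "u $ i < T"
          using that by (simp add: W_def)
        then have "\<delta> * (2 * real (u $ i) + 1) \<le> \<delta> * (2 * real T)"
          using \<open>0 < \<delta>\<close> by (intro mult_left_mono) auto
        moreover have "0 \<le> \<delta> * (2 * real (u $ i))"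
          using \<open>0 < \<delta>\<close> by simp
        moreover have "2 * real T * \<delta> = \<delta> * (2 * real T)"
          by simp
        ultimately show ?thesis
          using zlo[OF that, of i] zhi[OF that, of i] by linarith
      qed
      from this[OF that(1)] this[OF that(2)] show ?thesis
        by linarith
    qed
    then show ?thesis
      using norm_le_l1_cart[of "z v - z w"]
        sum_mono[of UNIV "\<lambda>i. \<bar>(z v - z w) $ i\<bar>" "\<lambda>_. 2 * real T * \<delta>"]
      by (simp add: dist_norm)
  qed
  \<comment> \<open>With this \<open>s\<close> the separation \<open>a * \<delta>\<close> of the images is exactly \<open>d * s\<close>, as \<open>packing_bound\<close> asks.\<close>
  define s where "s = a * \<delta> / real CARD('d)"
  have "0 < s"
    using \<open>0 < a\<close> \<open>0 < \<delta>\<close> by (simp add: s_def)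
  have "card W \<le> (2 * (Q * T) + 1) ^ ?m"
  proof (rule packing_bound[where f = "\<lambda>w. \<phi> (z w)" and ?w0.0 = 0])
    fix v w assume vw: "v \<in> W" "w \<in> W" "v \<noteq> w"
    have "real (Suc ?m) * s = a * \<delta>"
      by (simp add: s_def flip: card_d)
    also have "\<dots> \<le> a * dist (z v) (z w)"
      using sep[OF vw] \<open>0 < a\<close> by simp
    also have "\<dots> \<le> L2_set (\<lambda>i. \<phi> (z v) i - \<phi> (z w) i) {..<?m}"
      using lower zS vw by blast
    finally show "real (Suc ?m) * s \<le> L2_set (\<lambda>i. \<phi> (z v) i - \<phi> (z w) i) {..<?m}" .
  next
    fix w assume w: "w \<in> W"
    have "0 \<in> W"
      by (simp add: W_def T_def)
    have "L2_set (\<lambda>i. \<phi> (z w) i - \<phi> (z 0) i) {..<?m} \<le> b * dist (z w) (z 0)"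
      using upper zS w \<open>0 \<in> W\<close> by blast
    also have "\<dots> \<le> b * (real CARD('d) * (2 * real T * \<delta>))"
      using diam[OF w \<open>0 \<in> W\<close>] \<open>0 < a\<close> \<open>a \<le> b\<close> by (intro mult_left_mono) auto
    also have "\<dots> = 2 * b * real CARD('d) * real CARD('d) / a * (real T * s)"
      using \<open>0 < a\<close> by (simp add: s_def)
    also have "\<dots> \<le> real Q * (real T * s)"
      using Q \<open>0 < s\<close> by (intro mult_right_mono) auto
    finally show "L2_set (\<lambda>i. \<phi> (z w) i - \<phi> (z 0) i) {..<?m} \<le> real (Q * T) * s"
      by simp
  qed fact
  also have "\<dots> \<le> ((2 * Q + 1) * T) ^ ?m"
    by (intro power_mono) (auto simp: T_def algebra_simps)
  also have "\<dots> = (2 * Q + 1) ^ ?m * T ^ ?m"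
    by (rule power_mult_distrib)
  also have "card W = T * T ^ ?m"
    unfolding W_def card_box_nat_vec by (metis card_d power_Suc)
  finally have "T * T ^ ?m \<le> (2 * Q + 1) ^ ?m * T ^ ?m" .
  then have "T \<le> (2 * Q + 1) ^ ?m"
    by (rule mult_right_le_imp_le) (simp add: T_def)
  then show False
    by (simp add: T_def)
qed

section \<open>Self-similarity of the limit set\<close>

definition mesh_addresses :: "nat \<Rightarrow> (nat \<times> (nat ^ 'd::finite)) set" where
  "mesh_addresses n = (SIGMA k:{1..}. mesh_index n k)"

text \<open>
  A retention pattern \<open>\<kappa>\<close> is treated as its own sample point, with the coordinate evaluations as
  retention variables. In this form the patterns of different subtrees are values of one type.
\<close>
definition limit_set :: "nat \<Rightarrow> (nat \<times> (nat ^ 'd::finite) \<Rightarrow> bool) \<Rightarrow> (real ^ 'd) set" where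
  "limit_set n \<kappa> = percolation_set n (\<lambda>a \<kappa>. \<kappa> a) \<kappa>"

definition survivors :: "nat \<Rightarrow> (nat \<times> (nat ^ 'd::finite) \<Rightarrow> bool) \<Rightarrow> nat \<Rightarrow> (nat ^ 'd) set" where
  "survivors n \<kappa> k = surviving n (\<lambda>a \<kappa>. \<kappa> a) \<kappa> k"

text \<open>
  The level \<open>k + 1\<close> index of the cube that has index \<open>j\<close> at level \<open>k\<close> relative to the first-generation
  cube \<open>c\<close>.
\<close>
definition nested_index :: "nat \<Rightarrow> nat \<Rightarrow> nat ^ 'd::finite \<Rightarrow> nat ^ 'd \<Rightarrow> nat ^ 'd" where
  "nested_index n k c j = (\<chi> i. n ^ k * c $ i + j $ i)"

text \<open>
  The pattern seen from the first-generation cube \<open>c\<close>. It is restricted to the meaningful addresses so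
  that it is a point of the product space over them.
\<close>
definition subtree ::
  "nat \<Rightarrow> nat ^ 'd::finite \<Rightarrow> (nat \<times> (nat ^ 'd) \<Rightarrow> bool) \<Rightarrow> nat \<times> (nat ^ 'd) \<Rightarrow> bool" where
  "subtree n c \<kappa> = (\<lambda>(k, j)\<in>mesh_addresses n. \<kappa> (Suc k, nested_index n k c j))"

text \<open>
  Survival and the existence of full descendants are obtained by iterating these two operators and
  taking countable unions or intersections. When \<open>E\<close> does, each of them describes an event, whose
  probability is an explicit function of the probability of \<open>E\<close>.
\<close>
definition some_child ::
  "nat \<Rightarrow> ((nat \<times> (nat ^ 'd::finite) \<Rightarrow> bool) \<Rightarrow> bool) \<Rightarrow> (nat \<times> (nat ^ 'd) \<Rightarrow> bool) \<Rightarrow> bool" where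
  "some_child n E \<kappa> \<longleftrightarrow> (\<exists>c\<in>mesh_index n 1. \<kappa> (1, c) \<and> E (subtree n c \<kappa>))"

definition every_child ::
  "nat \<Rightarrow> ((nat \<times> (nat ^ 'd::finite) \<Rightarrow> bool) \<Rightarrow> bool) \<Rightarrow> (nat \<times> (nat ^ 'd) \<Rightarrow> bool) \<Rightarrow> bool" where
  "every_child n E \<kappa> \<longleftrightarrow> (\<forall>c\<in>mesh_index n 1. \<kappa> (1, c) \<and> E (subtree n c \<kappa>))"

lemma survivors_0 [simp]: "survivors n \<kappa> 0 = {0}"
  by (auto simp: survivors_def mesh_index_def vec_eq_iff)

lemma survivors_Suc:
  "survivors n \<kappa> (Suc k) =
     {j \<in> mesh_index n (Suc k). (\<chi> i. j $ i div n) \<in> survivors n \<kappa> k \<and> \<kappa> (Suc k, j)}"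
  by (simp add: survivors_def)

lemma survivors_subset_mesh_index: "survivors n \<kappa> k \<subseteq> mesh_index n k"
  by (cases k) (auto simp: survivors_Suc mesh_index_def)

lemma surviving_eq_survivors:
  "surviving n keep \<omega> k = survivors n (\<lambda>a\<in>mesh_addresses n. keep a \<omega>) k"
proof (induction k)
  case 0
  show ?case
    by (simp add: survivors_def)
next
  case (Suc k)
  have "(Suc k, j) \<in> mesh_addresses n \<longleftrightarrow> j \<in> mesh_index n (Suc k)" for j
    by (simp add: mesh_addresses_def)
  then show ?case
    by (auto simp: survivors_Suc Suc.IH)
qed

lemma percolation_set_eq_limit_set:
  "percolation_set n keep \<omega> = limit_set n (\<lambda>a\<in>mesh_addresses n. keep a \<omega>)"
  unfolding limit_set_def percolation_set_def percolation_stage_def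
  unfolding surviving_eq_survivors[of n keep] survivors_def ..

lemma limit_set_eq: "limit_set n \<kappa> = (\<Inter>k. \<Union>j\<in>survivors n \<kappa> k. mesh_cube n k j)"
  by (simp add: limit_set_def percolation_set_def percolation_stage_def survivors_def)

lemma mem_mesh_cube:
  "n > 0 \<Longrightarrow> x \<in> mesh_cube n k j \<longleftrightarrow>
     (\<forall>i. real (j $ i) \<le> x $ i * real n ^ k \<and> x $ i * real n ^ k \<le> real (j $ i) + 1)"
  by (auto simp: mesh_cube_def mem_box_cart field_simps)

lemma nested_index_in_mesh_index:
  assumes "c \<in> mesh_index n 1" "j \<in> mesh_index n k"
  shows "nested_index n k c j \<in> mesh_index n (Suc k)"
proof -
  have "n ^ k * c $ i + j $ i < n ^ Suc k" for i
  proof -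
    have "n ^ k * c $ i + j $ i < n ^ k * c $ i + n ^ k"
      using assms(2) by (simp add: mesh_index_def)
    also have "\<dots> = n ^ k * Suc (c $ i)"
      by simp
    also have "\<dots> \<le> n ^ k * n"
      using assms(1) by (intro mult_left_mono) (auto simp: mesh_index_def Suc_le_eq)
    finally show ?thesis
      by (simp add: mult.commute)
  qed
  then show ?thesis
    by (simp add: mesh_index_def nested_index_def)
qed

lemma nested_index_cases:
  assumes "v \<in> mesh_index n (Suc k)"
  obtains c j where "c \<in> mesh_index n 1" "j \<in> mesh_index n k" "v = nested_index n k c j"
proof
  have lt: "v $ i < n ^ k * n" for i
    using assms by (simp add: mesh_index_def mult.commute)
  then have pos: "n ^ k > 0"
    by (metis gr0I less_nat_zero_code mult_0)
  show "(\<chi> i. v $ i div n ^ k) \<in> mesh_index n 1"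
    using lt by (simp add: mesh_index_def less_mult_imp_div_less mult.commute)
  show "(\<chi> i. v $ i mod n ^ k) \<in> mesh_index n k"
    using pos by (simp add: mesh_index_def)
  show "v = nested_index n k (\<chi> i. v $ i div n ^ k) (\<chi> i. v $ i mod n ^ k)"
    by (simp add: nested_index_def vec_eq_iff)
qed

lemma nested_index_inject:
  assumes "j \<in> mesh_index n k" "j' \<in> mesh_index n k"
    and "nested_index n k c j = nested_index n k c' j'"
  shows "c = c' \<and> j = j'"
proof -
  have "c $ i = c' $ i \<and> j $ i = j' $ i" for i
  proof -
    have eq: "j $ i + n ^ k * c $ i = j' $ i + n ^ k * c' $ i" and lt: "j $ i < n ^ k" "j' $ i < n ^ k"
      using assms by (auto simp: nested_index_def mesh_index_def vec_eq_iff add.commute)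
    from arg_cong[OF eq, of "\<lambda>x. x mod n ^ k"] lt have "j $ i = j' $ i"
      by simp
    with eq lt show ?thesis
      by (metis add_left_cancel less_nat_zero_code mult_cancel1)
  qed
  then show ?thesis
    by (simp add: vec_eq_iff)
qed

lemma nested_index_Suc_div:
  "n > 0 \<Longrightarrow> (\<chi> i. nested_index n (Suc k) c j $ i div n) = nested_index n k c (\<chi> i. j $ i div n)"
proof -
  assume "n > 0"
  have "(n ^ Suc k * a + b) div n = n ^ k * a + b div n" for a b :: nat
    using \<open>n > 0\<close> by (simp add: mult.assoc)
  then show ?thesis
    by (simp add: nested_index_def vec_eq_iff)
qed

text \<open>
  Survival is defined by looking at the parent of a cube, that is, from the smallest cube upwards;
  here the same condition is split at the first generation.
\<close>
lemma nested_index_mem_survivors_iff: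
  assumes "n > 0" "c \<in> mesh_index n 1" "j \<in> mesh_index n k"
  shows "nested_index n k c j \<in> survivors n \<kappa> (Suc k) \<longleftrightarrow> \<kappa> (1, c) \<and> j \<in> survivors n (subtree n c \<kappa>) k"
  using assms(3)
proof (induction k arbitrary: j)
  case 0
  then have "j = 0"
    by (auto simp: mesh_index_def vec_eq_iff)
  moreover have "nested_index n 0 c 0 = c" "(\<chi> i. c $ i div n) = 0"
    using assms(2) by (auto simp: nested_index_def vec_eq_iff mesh_index_def)
  ultimately show ?case
    using assms(2) by (auto simp: survivors_Suc)
next
  case (Suc k)
  have "j $ i div n < n ^ k" for i
    using Suc.prems \<open>n > 0\<close> by (simp add: mesh_index_def less_mult_imp_div_less mult.commute)
  then have "(\<chi> i. j $ i div n) \<in> mesh_index n k"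
    by (simp add: mesh_index_def)
  note IH = Suc.IH[OF this]
  have "subtree n c \<kappa> (Suc k, j) = \<kappa> (Suc (Suc k), nested_index n (Suc k) c j)"
    using Suc.prems by (simp add: subtree_def mesh_addresses_def)
  then show ?case
    using IH Suc.prems nested_index_in_mesh_index[OF assms(2) Suc.prems]
    by (auto simp: survivors_Suc[of n _ "Suc k"] survivors_Suc[of n "subtree n c \<kappa>" k]
        nested_index_Suc_div[OF \<open>n > 0\<close>])
qed

lemma survivors_ne_Suc_iff:
  assumes "n > 0"
  shows "survivors n \<kappa> (Suc k) \<noteq> {} \<longleftrightarrow> some_child n (\<lambda>\<kappa>. survivors n \<kappa> k \<noteq> {}) \<kappa>"
proof
  assume "survivors n \<kappa> (Suc k) \<noteq> {}"
  then obtain v where v: "v \<in> survivors n \<kappa> (Suc k)"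
    by blast
  then obtain c j where "c \<in> mesh_index n 1" "j \<in> mesh_index n k" "v = nested_index n k c j"
    using nested_index_cases survivors_subset_mesh_index by blast
  then show "some_child n (\<lambda>\<kappa>. survivors n \<kappa> k \<noteq> {}) \<kappa>"
    using v nested_index_mem_survivors_iff[OF assms] unfolding some_child_def by blast
next
  assume "some_child n (\<lambda>\<kappa>. survivors n \<kappa> k \<noteq> {}) \<kappa>"
  then obtain c j where "c \<in> mesh_index n 1" "\<kappa> (1, c)" "j \<in> survivors n (subtree n c \<kappa>) k"
    by (auto simp: some_child_def)
  then show "survivors n \<kappa> (Suc k) \<noteq> {}"
    using nested_index_mem_survivors_iff[OF assms] survivors_subset_mesh_index by blast
qed

lemma survivors_ne_iff_funpow:
  assumes "n > 0"
  shows "survivors n \<kappa> k \<noteq> {} \<longleftrightarrow> (some_child n ^^ k) (\<lambda>_. True) \<kappa>"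
proof (induction k arbitrary: \<kappa>)
  case (Suc k)
  then show ?case
    by (simp only: survivors_ne_Suc_iff[OF assms] funpow.simps comp_apply)
qed auto

lemma mesh_cube_Suc_subset:
  assumes "n > 0"
  shows "mesh_cube n (Suc k) j \<subseteq> mesh_cube n k (\<chi> i. j $ i div n)"
proof
  fix x assume x: "x \<in> mesh_cube n (Suc k) j"
  have "real (j $ i div n) \<le> x $ i * real n ^ k \<and> x $ i * real n ^ k \<le> real (j $ i div n) + 1" for i
  proof -
    let ?q = "j $ i div n" and ?y = "x $ i * real n ^ k"
    have "n * ?q \<le> j $ i" "j $ i + 1 \<le> n * (?q + 1)"
      using dividend_less_div_times[OF assms, of "j $ i"] by (auto simp: mult.commute)
    then have "real n * real ?q \<le> real (j $ i)" "real (j $ i) + 1 \<le> real n * (real ?q + 1)"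
      by (metis of_nat_le_iff of_nat_mult, metis of_nat_1 of_nat_add of_nat_le_iff of_nat_mult)
    moreover have "real (j $ i) \<le> real n * ?y" "real n * ?y \<le> real (j $ i) + 1"
      using x assms by (auto simp: mem_mesh_cube algebra_simps)
    ultimately have "real n * real ?q \<le> real n * ?y" "real n * ?y \<le> real n * (real ?q + 1)"
      by linarith+
    then show ?thesis
      using assms by (simp add: mult_le_cancel_left)
  qed
  then show "x \<in> mesh_cube n k (\<chi> i. j $ i div n)"
    using assms by (simp add: mem_mesh_cube)
qed

lemma stage_Suc_subset:
  assumes "n > 0"
  shows "(\<Union>j\<in>survivors n \<kappa> (Suc k). mesh_cube n (Suc k) j) \<subseteq> (\<Union>j\<in>survivors n \<kappa> k. mesh_cube n k j)"
proof (rule UN_least)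
  fix j assume "j \<in> survivors n \<kappa> (Suc k)"
  then have "(\<chi> i. j $ i div n) \<in> survivors n \<kappa> k"
    by (simp add: survivors_Suc)
  then show "mesh_cube n (Suc k) j \<subseteq> (\<Union>j\<in>survivors n \<kappa> k. mesh_cube n k j)"
    using mesh_cube_Suc_subset[OF assms, of k j] by blast
qed

text \<open>By compactness of the stages, extinction of \<open>F\<close> is already visible at a finite level.\<close>
lemma limit_set_ne_iff:
  assumes "n > 0"
  shows "limit_set n \<kappa> \<noteq> {} \<longleftrightarrow> (\<forall>k. survivors n \<kappa> k \<noteq> {})"
proof
  assume "limit_set n \<kappa> \<noteq> {}"
  then show "\<forall>k. survivors n \<kappa> k \<noteq> {}"
    by (auto simp: limit_set_eq)
next
  assume ne: "\<forall>k. survivors n \<kappa> k \<noteq> {}"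
  let ?Q = "\<lambda>k. \<Union>j\<in>survivors n \<kappa> k. mesh_cube n k j"
  have "\<Inter>(range ?Q) \<noteq> {}"
  proof (rule compact_nest)
    fix k
    have "finite (survivors n \<kappa> k)"
      using survivors_subset_mesh_index[of n \<kappa> k] finite_box_nat_vec finite_subset
      unfolding mesh_index_def by blast
    then show "compact (?Q k)"
      by (auto simp: mesh_cube_def)
    have "mesh_cube n k j \<noteq> {}" for j :: "nat ^ 'a"
      using assms by (auto simp: mesh_cube_def interval_ne_empty_cart divide_right_mono)
    then show "?Q k \<noteq> {}"
      using ne by auto
  next
    fix l k :: nat
    assume "l \<le> k"
    then show "?Q k \<subseteq> ?Q l"
      by (rule lift_Suc_antimono_le[of ?Q, OF stage_Suc_subset[OF assms]])
  qed
  then show "limit_set n \<kappa> \<noteq> {}"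
    by (simp add: limit_set_eq)
qed

lemma limit_set_subset_unit_cube: "x \<in> limit_set n \<kappa> \<Longrightarrow> x \<in> mesh_cube n 0 0"
  by (auto simp: limit_set_eq dest!: spec[of _ 0])

text \<open>The similarity of ratio \<open>1 / n\<close> that maps the unit cube onto the first-generation cube \<open>c\<close>.\<close>
definition into_child :: "nat \<Rightarrow> nat ^ 'd::finite \<Rightarrow> real ^ 'd \<Rightarrow> real ^ 'd" where
  "into_child n c x = (\<chi> i. (real (c $ i) + x $ i) / real n)"

lemma into_child_mesh_cube:
  assumes "n > 0" "x \<in> mesh_cube n k j"
  shows "into_child n c x \<in> mesh_cube n (Suc k) (nested_index n k c j)"
proof -
  have "into_child n c x $ i * real n ^ Suc k = real (c $ i) * real n ^ k + x $ i * real n ^ k" for i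
    using assms(1) by (simp add: into_child_def field_simps)
  then show ?thesis
    using assms by (simp add: mem_mesh_cube nested_index_def algebra_simps)
qed

lemma into_child_limit_set:
  assumes "n > 0" "c \<in> mesh_index n 1" "\<kappa> (1, c)" "x \<in> limit_set n (subtree n c \<kappa>)"
  shows "into_child n c x \<in> limit_set n \<kappa>"
  unfolding limit_set_eq
proof
  fix k
  obtain j where j: "j \<in> survivors n (subtree n c \<kappa>) k" "x \<in> mesh_cube n k j"
    using assms(4) by (auto simp: limit_set_eq)
  then have "nested_index n k c j \<in> survivors n \<kappa> (Suc k)"
    using assms(3) nested_index_mem_survivors_iff[OF assms(1,2)]
      subsetD[OF survivors_subset_mesh_index j(1)] by simp
  then have "into_child n c x \<in> (\<Union>j\<in>survivors n \<kappa> (Suc k). mesh_cube n (Suc k) j)"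
    using into_child_mesh_cube[OF assms(1) j(2)] by blast
  then show "into_child n c x \<in> (\<Union>j\<in>survivors n \<kappa> k. mesh_cube n k j)"
    using stage_Suc_subset[OF assms(1)] by blast
qed

text \<open>
  If the first \<open>l\<close> generations are completely retained and every cube of generation \<open>l\<close> has a
  surviving subtree, the points found in these subtrees reach every cell of the mesh.
\<close>
lemma every_child_hits_mesh:
  assumes "n > 0" "(every_child n ^^ l) (\<lambda>\<kappa>. limit_set n \<kappa> \<noteq> {}) \<kappa>" "v \<in> mesh_index n l"
  shows "\<exists>y\<in>limit_set n \<kappa>. y \<in> mesh_cube n l v"
  using assms(2,3)
proof (induction l arbitrary: \<kappa> v)
  case 0
  then have "v = 0"
    by (auto simp: mesh_index_def vec_eq_iff)
  with 0 show ?case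
    using limit_set_subset_unit_cube by auto
next
  case (Suc l)
  obtain c j where cj: "c \<in> mesh_index n 1" "j \<in> mesh_index n l" "v = nested_index n l c j"
    using nested_index_cases[OF Suc.prems(2)] .
  then have "\<kappa> (1, c)" "(every_child n ^^ l) (\<lambda>\<kappa>. limit_set n \<kappa> \<noteq> {}) (subtree n c \<kappa>)"
    using Suc.prems(1) by (auto simp: every_child_def[of n _ \<kappa>])
  then show ?case
    using Suc.IH cj into_child_limit_set[of n c \<kappa>] into_child_mesh_cube assms(1) by blast
qed

lemma every_child_imp_coarse_grid:
  assumes "n > 0" "(every_child n ^^ l) (\<lambda>\<kappa>. limit_set n \<kappa> \<noteq> {}) \<kappa>" "T \<le> n ^ l"
  shows "coarse_grid T (limit_set n \<kappa>)"
proof -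
  have "\<exists>y\<in>limit_set n \<kappa>. \<forall>i. 0 $ i + 1 / real n ^ l * real (v $ i) \<le> y $ i \<and>
          y $ i \<le> 0 $ i + 1 / real n ^ l * (real (v $ i) + 1)"
    if "\<forall>i. v $ i < T" for v
  proof -
    have "v \<in> mesh_index n l"
      using that less_le_trans[OF _ assms(3)] by (simp add: mesh_index_def)
    then obtain y where "y \<in> limit_set n \<kappa>" "y \<in> mesh_cube n l v"
      using every_child_hits_mesh[OF assms(1,2)] by blast
    then show ?thesis
      by (intro bexI[of _ y]) (auto simp: mesh_cube_def mem_box_cart)
  qed
  then show ?thesis
    unfolding coarse_grid_def using assms(1) by (intro exI[of _ 0] exI[of _ "1 / real n ^ l"]) simp
qed

text \<open>Grids found in a retained descendant are carried to the whole set by the similarities.\<close>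
lemma some_child_imp_coarse_grid:
  assumes "n > 0" "(some_child n ^^ m) E \<kappa>" "\<And>\<kappa>. E \<kappa> \<Longrightarrow> coarse_grid T (limit_set n \<kappa>)"
  shows "coarse_grid T (limit_set n \<kappa>)"
  using assms(2)
proof (induction m arbitrary: \<kappa>)
  case 0
  then show ?case by (simp add: assms(3))
next
  case (Suc m)
  then obtain c where c: "c \<in> mesh_index n 1" "\<kappa> (1, c)" "(some_child n ^^ m) E (subtree n c \<kappa>)"
    by (auto simp: some_child_def[of n _ \<kappa>])
  obtain x \<delta> where "\<delta> > 0" and grid: "\<And>v. \<forall>i. v $ i < T \<Longrightarrow> \<exists>y\<in>limit_set n (subtree n c \<kappa>).
      \<forall>i. x $ i + \<delta> * real (v $ i) \<le> y $ i \<and> y $ i \<le> x $ i + \<delta> * (real (v $ i) + 1)"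
    using Suc.IH[OF c(3)] unfolding coarse_grid_def by blast
  have "\<exists>y\<in>limit_set n \<kappa>. \<forall>i. into_child n c x $ i + \<delta> / real n * real (v $ i) \<le> y $ i \<and>
          y $ i \<le> into_child n c x $ i + \<delta> / real n * (real (v $ i) + 1)"
    if v: "\<forall>i. v $ i < T" for v
  proof -
    obtain y where y: "y \<in> limit_set n (subtree n c \<kappa>)"
      and "\<forall>i. x $ i + \<delta> * real (v $ i) \<le> y $ i \<and> y $ i \<le> x $ i + \<delta> * (real (v $ i) + 1)"
      using grid[OF v] by blast
    moreover have shift: "into_child n c x $ i + \<delta> / real n * r = (real (c $ i) + (x $ i + \<delta> * r)) / real n"
      for i r
      by (simp add: into_child_def add_divide_distrib)
    ultimately have "\<forall>i. into_child n c x $ i + \<delta> / real n * real (v $ i) \<le> into_child n c y $ i \<and>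
        into_child n c y $ i \<le> into_child n c x $ i + \<delta> / real n * (real (v $ i) + 1)"
      unfolding shift by (simp add: into_child_def divide_right_mono)
    with into_child_limit_set[OF assms(1) c(1,2) y] show ?thesis
      by blast
  qed
  then show ?case
    unfolding coarse_grid_def using assms(1) \<open>\<delta> > 0\<close>
    by (intro exI[of _ "into_child n c x"] exI[of _ "\<delta> / real n"]) simp
qed

section \<open>Survival equations for branching processes\<close>

lemma one_minus_power_eq:
  fixes p x :: real
  shows "1 - (1 - p * x) ^ N = p * x * (\<Sum>i<N. (1 - p * x) ^ i)"
  by (simp add: one_diff_power_eq)

text \<open>
  Dividing \<open>1 - (1 - p * x) ^ N\<close> by \<open>x\<close> gives \<open>p * (\<Sum>i<N. (1 - p * x) ^ i)\<close>, which is strictly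
  decreasing in \<open>x\<close> once \<open>N \<ge> 2\<close>. It is at least 1 at \<open>s\<close> and at most 1 at \<open>g\<close>.
\<close>
lemma survival_fixed_point_unique:
  fixes p g s :: real
  assumes "0 < p" "p \<le> 1" "2 \<le> N" and "0 < g" "g \<le> s" "s \<le> 1"
    and sub: "s \<le> 1 - (1 - p * s) ^ N" and super: "1 - (1 - p * g) ^ N \<le> g"
  shows "g = s"
proof (rule ccontr)
  assume "g \<noteq> s"
  then have "g < s"
    using \<open>g \<le> s\<close> by simp
  have "p * s \<le> 1"
    using assms mult_mono[of p 1 s 1] by simp
  then have nonneg: "0 \<le> 1 - p * s" and less: "1 - p * s < 1 - p * g"
    using \<open>g < s\<close> \<open>0 < p\<close> by auto
  have "(\<Sum>i<N. (1 - p * s) ^ i) < (\<Sum>i<N. (1 - p * g) ^ i)"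
  proof (rule sum_strict_mono_ex1)
    show "\<forall>i\<in>{..<N}. (1 - p * s) ^ i \<le> (1 - p * g) ^ i"
      using nonneg less by (auto intro!: power_mono)
    show "\<exists>i\<in>{..<N}. (1 - p * s) ^ i < (1 - p * g) ^ i"
      using less \<open>2 \<le> N\<close> by (intro bexI[of _ 1]) auto
  qed simp
  moreover have "1 \<le> p * (\<Sum>i<N. (1 - p * s) ^ i)"
    using sub assms(4,5) by (simp add: one_minus_power_eq mult.assoc mult.left_commute[of p s])
  moreover have "p * (\<Sum>i<N. (1 - p * g) ^ i) \<le> 1"
    using super assms(4) by (simp add: one_minus_power_eq mult.assoc mult.left_commute[of p g])
  ultimately show False
    using \<open>0 < p\<close> by (smt (verit) mult_less_cancel_left_pos)
qed

text \<open>
  Such a \<open>c\<close> is a lower bound for all survival probabilities up to finite generations. It exists because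
  the map has slope \<open>p * N > 1\<close> at 0.
\<close>
lemma supercritical_subsolution:
  fixes p :: real
  assumes "0 < p" "p \<le> 1" "1 < p * real N"
  obtains c where "0 < c" "c \<le> 1" "c \<le> 1 - (1 - p * c) ^ N"
proof
  define \<mu> where "\<mu> = p * real N"
  \<comment> \<open>The Bernoulli bound for the power sum makes \<open>c * \<mu> * (1 - \<mu> * c)\<close> a lower bound; \<open>c\<close> makes it equal to \<open>c\<close>.\<close>
  define c where "c = (\<mu> - 1) / \<mu>\<^sup>2"
  have "1 < \<mu>"
    using assms by (simp add: \<mu>_def)
  then show "0 < c"
    by (simp add: c_def)
  have "\<mu> - 1 \<le> \<mu>\<^sup>2"
    using \<open>1 < \<mu>\<close> by (smt (verit) power2_eq_square mult_le_cancel_left1)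
  then show "c \<le> 1"
    using \<open>1 < \<mu>\<close> by (simp add: c_def)
  have "p * c \<le> 1"
    using assms \<open>0 < c\<close> \<open>c \<le> 1\<close> mult_mono[of p 1 c 1] by simp
  have "c = p * c * (\<Sum>i<N. 1 - real N * (p * c))"
    using \<open>1 < \<mu>\<close> assms by (simp add: c_def \<mu>_def field_simps power2_eq_square)
  also have "\<dots> \<le> p * c * (\<Sum>i<N. (1 - p * c) ^ i)"
  proof (intro mult_left_mono sum_mono)
    fix i assume "i \<in> {..<N}"
    then have "real i * (p * c) \<le> real N * (p * c)"
      using assms \<open>0 < c\<close> by (intro mult_right_mono) auto
    then show "1 - real N * (p * c) \<le> (1 - p * c) ^ i"
      using Bernoulli_inequality[of "- (p * c)" i] \<open>p * c \<le> 1\<close> by simp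
  qed (use assms \<open>0 < c\<close> in simp)
  finally show "c \<le> 1 - (1 - p * c) ^ N"
    by (simp only: one_minus_power_eq)
qed

section \<open>Independent identically distributed subtrees\<close>

definition retention_measure :: "nat \<Rightarrow> real \<Rightarrow> (nat \<times> (nat ^ 'd::finite) \<Rightarrow> bool) measure" where
  "retention_measure n p = PiM (mesh_addresses n) (\<lambda>_. measure_pmf (bernoulli_pmf p))"

text \<open>The address that \<open>subtree n c\<close> reads at the address \<open>a\<close>.\<close>
definition descend :: "nat \<Rightarrow> nat ^ 'd::finite \<Rightarrow> nat \<times> (nat ^ 'd) \<Rightarrow> nat \<times> (nat ^ 'd)" where
  "descend n c a = (Suc (fst a), nested_index n (fst a) c (snd a))"

lemma subtree_eq: "subtree n c \<kappa> = (\<lambda>a\<in>mesh_addresses n. \<kappa> (descend n c a))"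
  by (simp add: subtree_def descend_def case_prod_beta')

lemma first_generation_addresses [simp]: "c \<in> mesh_index n 1 \<Longrightarrow> (1, c) \<in> mesh_addresses n"
  by (simp add: mesh_addresses_def)

lemma descend_addresses: "c \<in> mesh_index n 1 \<Longrightarrow> descend n c \<in> mesh_addresses n \<rightarrow> mesh_addresses n"
  using nested_index_in_mesh_index by (auto simp: descend_def mesh_addresses_def)

lemma descend_inject:
  assumes "a \<in> mesh_addresses n" "b \<in> mesh_addresses n" "descend n c a = descend n c' b"
  shows "c = c' \<and> a = b"
proof -
  have "nested_index n (fst a) c (snd a) = nested_index n (fst a) c' (snd b)" "fst a = fst b"
    and "snd a \<in> mesh_index n (fst a)" "snd b \<in> mesh_index n (fst a)"
    using assms by (auto simp: descend_def mesh_addresses_def)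
  then show ?thesis
    using nested_index_inject[of "snd a" n "fst a" "snd b" c c'] by (simp add: prod_eq_iff)
qed

lemma inj_on_descend: "inj_on (descend n c) (mesh_addresses n)"
  by (rule inj_onI) (rule descend_inject[THEN conjunct2])

lemma descend_ne_first_generation: "a \<in> mesh_addresses n \<Longrightarrow> descend n c a \<noteq> (1, c')"
  by (auto simp: descend_def mesh_addresses_def)

lemma prob_space_retention_measure: "prob_space (retention_measure n p)"
  unfolding retention_measure_def by (intro prob_space_PiM measure_pmf.prob_space_axioms)

lemma measurable_coordinate:
  "a \<in> mesh_addresses n \<Longrightarrow> (\<lambda>\<kappa>. \<kappa> a) \<in> measurable (retention_measure n p) (count_space UNIV)"
  unfolding retention_measure_def
  using measurable_component_singleton[of a "mesh_addresses n" "\<lambda>_. measure_pmf (bernoulli_pmf p)"]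
  by simp

lemma measurable_reindex:
  assumes "f \<in> mesh_addresses n \<rightarrow> K"
  shows "(\<lambda>\<kappa>. \<lambda>a\<in>mesh_addresses n. \<kappa> (f a))
           \<in> measurable (PiM K (\<lambda>_. count_space UNIV)) (retention_measure n p)"
  unfolding retention_measure_def
  using assms by (intro measurable_restrict) (auto intro: measurable_component_singleton)

lemma sets_retention_measure:
  "sets (retention_measure n p) = sets (PiM (mesh_addresses n) (\<lambda>_. count_space UNIV))"
  unfolding retention_measure_def by (intro sets_PiM_cong) auto

lemma measurable_subtree:
  assumes "c \<in> mesh_index n 1"
  shows "subtree n c \<in> measurable (retention_measure n p) (retention_measure n p)"
  using measurable_reindex[OF descend_addresses[OF assms], of p]
  by (simp add: subtree_eq[abs_def] measurable_cong_sets[OF sets_retention_measure refl])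

text \<open>Reading a product measure of identical factors along an injection of addresses reproduces it.\<close>
lemma distr_subtree:
  assumes "c \<in> mesh_index n 1"
  shows "distr (retention_measure n p) (retention_measure n p) (subtree n c) = retention_measure n p"
  using distr_PiM_reindex[OF _ inj_on_descend descend_addresses[OF assms],
      of "\<lambda>_. measure_pmf (bernoulli_pmf p)"]
  by (simp add: retention_measure_def subtree_eq[abs_def] measure_pmf.prob_space_axioms)

lemma distr_coordinate:
  assumes "a \<in> mesh_addresses n"
  shows "distr (retention_measure n p) (count_space UNIV) (\<lambda>\<kappa>. \<kappa> a) = measure_pmf (bernoulli_pmf p)"
proof -
  have "distr (retention_measure n p) (count_space UNIV) (\<lambda>\<kappa>. \<kappa> a)
      = distr (retention_measure n p) (measure_pmf (bernoulli_pmf p)) (\<lambda>\<kappa>. \<kappa> a)"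
    by (intro distr_cong) auto
  then show ?thesis
    using distr_PiM_component[OF _ assms, of "\<lambda>_. measure_pmf (bernoulli_pmf p)"]
    by (simp add: retention_measure_def measure_pmf.prob_space_axioms)
qed

text \<open>The law of the coordinates is by construction the product of their laws.\<close>
lemma indep_coordinates:
  "prob_space.indep_vars (retention_measure n p) (\<lambda>_. count_space UNIV) (\<lambda>a \<kappa>. \<kappa> a)
     (mesh_addresses n :: (nat \<times> (nat ^ 'd::finite)) set)"
proof (cases "(mesh_addresses n :: (nat \<times> (nat ^ 'd)) set) = {}")
  case True
  interpret prob_space "retention_measure n p"
    by (rule prob_space_retention_measure)
  show ?thesis
    unfolding True by (simp add: indep_vars_def2 indep_sets_def)
next
  case False
  interpret prob_space "retention_measure n p"
    by (rule prob_space_retention_measure)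
  let ?I = "mesh_addresses n :: (nat \<times> (nat ^ 'd)) set"
  have "distr (retention_measure n p) (PiM ?I (\<lambda>_. count_space UNIV)) (\<lambda>\<kappa>. \<lambda>a\<in>?I. \<kappa> a)
      = distr (retention_measure n p) (retention_measure n p) (\<lambda>\<kappa>. \<kappa>)"
  proof (rule distr_cong[OF refl])
    show "sets (PiM ?I (\<lambda>_. count_space UNIV)) = sets (retention_measure n p)"
      by (rule sets_retention_measure[symmetric])
    show "restrict \<kappa> ?I = \<kappa>" if "\<kappa> \<in> space (retention_measure n p)" for \<kappa>
      using that by (simp add: retention_measure_def space_PiM PiE_def extensional_restrict)
  qed
  also have "\<dots> = PiM ?I (\<lambda>a. distr (retention_measure n p) (count_space UNIV) (\<lambda>\<kappa>. \<kappa> a))"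
    by (simp add: retention_measure_def distr_coordinate[unfolded retention_measure_def] cong: PiM_cong)
  finally show ?thesis
    by (subst indep_vars_iff_distr_eq_PiM'[OF False]) (auto intro: measurable_coordinate)
qed

lemma finite_mesh_index: "finite (mesh_index n k)"
  and card_mesh_index: "card (mesh_index n k :: (nat ^ 'd::finite) set) = (n ^ k) ^ CARD('d)"
  by (simp_all add: mesh_index_def finite_box_nat_vec card_box_nat_vec)

lemma pred_child_event:
  assumes "Measurable.pred (retention_measure n p) E" "c \<in> mesh_index n 1"
  shows "Measurable.pred (retention_measure n p) (\<lambda>\<kappa>. \<kappa> (1, c) \<and> E (subtree n c \<kappa>))"
  using measurable_coordinate[OF first_generation_addresses[OF assms(2)]]
    measurable_compose[OF measurable_subtree[OF assms(2)] assms(1)]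
  by (intro pred_intros_logic)

text \<open>
  The retention of \<open>c\<close> and the subtree at \<open>c\<close> read disjoint sets of coordinates, and the subtree is
  distributed like the whole pattern.
\<close>
lemma prob_child_event:
  assumes "0 \<le> p" "p \<le> 1" and E: "Measurable.pred (retention_measure n p) E"
    and c: "c \<in> mesh_index n 1"
  shows "measure (retention_measure n p) {\<kappa> \<in> space (retention_measure n p). \<kappa> (1, c) \<and> E (subtree n c \<kappa>)}
       = p * measure (retention_measure n p) {\<kappa> \<in> space (retention_measure n p). E \<kappa>}"
proof -
  let ?R = "retention_measure n p" and ?I = "mesh_addresses n"
  interpret prob_space ?R
    by (rule prob_space_retention_measure)
  have "indep_var (PiM {(1, c)} (\<lambda>_. count_space UNIV)) (\<lambda>\<kappa>. restrict \<kappa> {(1, c)})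
      (PiM (descend n c ` ?I) (\<lambda>_. count_space UNIV)) (\<lambda>\<kappa>. restrict \<kappa> (descend n c ` ?I))"
  proof (rule indep_var_restrict[OF indep_coordinates])
    show "{(1, c)} \<inter> descend n c ` ?I = {}"
      using descend_ne_first_generation[of _ n c c] by (metis disjoint_iff image_iff singletonD)
    show "{(1, c)} \<subseteq> ?I" "descend n c ` ?I \<subseteq> ?I"
      using first_generation_addresses[OF c] funcset_image[OF descend_addresses[OF c]] by simp_all
  qed
  then have "indep_var (count_space UNIV) ((\<lambda>\<kappa>. \<kappa> (1, c)) \<circ> (\<lambda>\<kappa>. restrict \<kappa> {(1, c)}))
      (count_space UNIV) ((\<lambda>\<kappa>. E (\<lambda>a\<in>?I. \<kappa> (descend n c a))) \<circ> (\<lambda>\<kappa>. restrict \<kappa> (descend n c ` ?I)))"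
  proof (rule indep_var_compose)
    show "(\<lambda>\<kappa>. \<kappa> (1, c)) \<in> measurable (PiM {(1, c)} (\<lambda>_. count_space UNIV)) (count_space UNIV)"
      by (rule measurable_component_singleton) simp
    show "(\<lambda>\<kappa>. E (\<lambda>a\<in>?I. \<kappa> (descend n c a)))
        \<in> measurable (PiM (descend n c ` ?I) (\<lambda>_. count_space UNIV)) (count_space UNIV)"
      by (rule measurable_compose[OF measurable_reindex E]) simp
  qed
  then have indep: "indep_var (count_space UNIV) (\<lambda>\<kappa>. \<kappa> (1, c)) (count_space UNIV) (\<lambda>\<kappa>. E (subtree n c \<kappa>))"
    by (simp add: comp_def subtree_eq cong: restrict_cong)
  have E': "{\<kappa> \<in> space ?R. E \<kappa>} \<in> sets ?R"
    using E by simp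
  have sub: "\<kappa> \<in> space ?R \<Longrightarrow> subtree n c \<kappa> \<in> space ?R" for \<kappa>
    using measurable_space[OF measurable_subtree[OF c]] .
  have "{\<kappa> \<in> space ?R. \<kappa> (1, c) \<and> E (subtree n c \<kappa>)}
      = (\<lambda>\<kappa>. (\<kappa> (1, c), E (subtree n c \<kappa>))) -` ({True} \<times> {True}) \<inter> space ?R"
    by auto
  also have "prob \<dots> = prob ((\<lambda>\<kappa>. \<kappa> (1, c)) -` {True} \<inter> space ?R)
      * prob ((\<lambda>\<kappa>. E (subtree n c \<kappa>)) -` {True} \<inter> space ?R)"
    by (rule indep_varD[OF indep]) simp_all
  also have "(\<lambda>\<kappa>. E (subtree n c \<kappa>)) -` {True} \<inter> space ?R = subtree n c -` {\<kappa> \<in> space ?R. E \<kappa>} \<inter> space ?R"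
    using sub by auto
  also have "prob (subtree n c -` {\<kappa> \<in> space ?R. E \<kappa>} \<inter> space ?R) = prob {\<kappa> \<in> space ?R. E \<kappa>}"
    using measure_distr[OF measurable_subtree[OF c] E'] by (simp add: distr_subtree[OF c])
  also have "prob ((\<lambda>\<kappa>. \<kappa> (1, c)) -` {True} \<inter> space ?R) = p"
    using measure_distr[OF measurable_coordinate[OF first_generation_addresses[OF c]], of "{True}" p]
      assms(1,2)
    by (simp only: distr_coordinate[OF first_generation_addresses[OF c]] measure_pmf_single) simp
  finally show ?thesis .
qed

text \<open>Different first-generation cubes own disjoint sets of coordinates.\<close>
lemma indep_child_events:
  fixes E :: "(nat \<times> (nat ^ 'd::finite) \<Rightarrow> bool) \<Rightarrow> bool"
  assumes E: "Measurable.pred (retention_measure n p) E"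
  shows "prob_space.indep_vars (retention_measure n p) (\<lambda>_. count_space UNIV)
           (\<lambda>c \<kappa>. \<kappa> (1, c) \<and> E (subtree n c \<kappa>)) (mesh_index n 1)"
proof -
  let ?R = "retention_measure n p" and ?I = "mesh_addresses n :: (nat \<times> (nat ^ 'd)) set"
  interpret prob_space ?R
    by (rule prob_space_retention_measure)
  let ?K = "\<lambda>c :: nat ^ 'd. insert (1, c) (descend n c ` ?I)"
  let ?Y = "\<lambda>c \<kappa>. \<kappa> (1, c) \<and> E (\<lambda>a\<in>?I. \<kappa> (descend n c a))"
  have "indep_vars (\<lambda>c. PiM (?K c) (\<lambda>_. count_space UNIV)) (\<lambda>c \<kappa>. restrict \<kappa> (?K c)) (mesh_index n 1)"
  proof (rule indep_vars_restrict[OF indep_coordinates])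
    show "?K c \<subseteq> ?I" if "c \<in> mesh_index n 1" for c :: "nat ^ 'd"
      using funcset_image[OF descend_addresses[OF that]] first_generation_addresses[OF that] by simp
    show "disjoint_family_on ?K (mesh_index n 1 :: (nat ^ 'd) set)"
      unfolding disjoint_family_on_def
    proof (intro ballI impI equals0I)
      fix c c' :: "nat ^ 'd" and a
      assume "c \<noteq> c'" "a \<in> ?K c \<inter> ?K c'"
      then consider "a = (1, c)" "a = (1, c')"
        | b where "a = (1, c)" "a = descend n c' b" "b \<in> ?I"
        | b where "a = descend n c b" "a = (1, c')" "b \<in> ?I"
        | b b' where "a = descend n c b" "a = descend n c' b'" "b \<in> ?I" "b' \<in> ?I"
        by (elim IntE insertE imageE) metis+
      then show False
      proof cases
        case 4
        then have "c = c'"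
          using descend_inject by metis
        with \<open>c \<noteq> c'\<close> show False ..
      qed (use \<open>c \<noteq> c'\<close> descend_ne_first_generation[of _ n c c']
            descend_ne_first_generation[of _ n c' c] in auto)
    qed
  qed
  then have "indep_vars (\<lambda>_. count_space UNIV) (\<lambda>c \<kappa>. ?Y c (restrict \<kappa> (?K c))) (mesh_index n 1)"
  proof (rule indep_vars_compose2)
    fix c
    have "(\<lambda>\<kappa>. \<lambda>a\<in>?I. \<kappa> (descend n c a)) \<in> measurable (PiM (?K c) (\<lambda>_. count_space UNIV)) ?R"
      by (rule measurable_reindex) auto
    from measurable_compose[OF this E]
    show "?Y c \<in> measurable (PiM (?K c) (\<lambda>_. count_space UNIV)) (count_space UNIV)"
      by (intro pred_intros_logic measurable_component_singleton) auto
  qed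
  then show ?thesis
    by (simp add: subtree_eq cong: restrict_cong)
qed

lemma pred_some_child:
  assumes "Measurable.pred (retention_measure n p) E"
  shows "Measurable.pred (retention_measure n p) (some_child n E)"
  unfolding some_child_def[abs_def]
  by (intro pred_intros_finite finite_mesh_index pred_child_event assms)

lemma pred_every_child:
  assumes "Measurable.pred (retention_measure n p) E"
  shows "Measurable.pred (retention_measure n p) (every_child n E)"
  unfolding every_child_def[abs_def]
  by (intro pred_intros_finite finite_mesh_index pred_child_event assms)

lemma pred_funpow:
  assumes "\<And>E. Measurable.pred M E \<Longrightarrow> Measurable.pred M (F E)" "Measurable.pred M E"
  shows "Measurable.pred M ((F ^^ k) E)"
  by (induction k) (simp_all add: assms)

lemma mesh_index_ne: "n > 0 \<Longrightarrow> mesh_index n k \<noteq> {}"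
  by (auto simp: mesh_index_def intro!: exI[of _ 0])

lemma prob_every_child:
  fixes E :: "(nat \<times> (nat ^ 'd::finite) \<Rightarrow> bool) \<Rightarrow> bool"
  assumes "n > 0" "0 \<le> p" "p \<le> 1" and E: "Measurable.pred (retention_measure n p) E"
  shows "measure (retention_measure n p) {\<kappa> \<in> space (retention_measure n p). every_child n E \<kappa>}
       = (p * measure (retention_measure n p) {\<kappa> \<in> space (retention_measure n p). E \<kappa>}) ^ (n ^ CARD('d))"
proof -
  let ?R = "retention_measure n p" and ?C = "mesh_index n 1 :: (nat ^ 'd) set"
  let ?X = "\<lambda>c \<kappa>. \<kappa> (1, c) \<and> E (subtree n c \<kappa>)"
  interpret prob_space ?R
    by (rule prob_space_retention_measure)
  have "{\<kappa> \<in> space ?R. every_child n E \<kappa>} = (\<Inter>c\<in>?C. ?X c -` {True} \<inter> space ?R)"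
    using mesh_index_ne[OF \<open>n > 0\<close>, of 1] by (auto simp: every_child_def)
  also have "prob \<dots> = (\<Prod>c\<in>?C. prob (?X c -` {True} \<inter> space ?R))"
    by (rule indep_varsD_finite[OF indep_child_events[OF E] mesh_index_ne[OF \<open>n > 0\<close>] finite_mesh_index])
       simp
  also have "\<dots> = (\<Prod>c\<in>?C. p * prob {\<kappa> \<in> space ?R. E \<kappa>})"
  proof (rule prod.cong[OF refl])
    fix c assume c: "c \<in> ?C"
    have "?X c -` {True} \<inter> space ?R = {\<kappa> \<in> space ?R. ?X c \<kappa>}"
      by auto
    then show "prob (?X c -` {True} \<inter> space ?R) = p * prob {\<kappa> \<in> space ?R. E \<kappa>}"
      by (simp only: prob_child_event[OF assms(2,3) E c])
  qed
  finally show ?thesis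
    by (simp add: card_mesh_index)
qed

lemma prob_some_child:
  fixes E :: "(nat \<times> (nat ^ 'd::finite) \<Rightarrow> bool) \<Rightarrow> bool"
  assumes "n > 0" "0 \<le> p" "p \<le> 1" and E: "Measurable.pred (retention_measure n p) E"
  shows "measure (retention_measure n p) {\<kappa> \<in> space (retention_measure n p). some_child n E \<kappa>}
       = 1 - (1 - p * measure (retention_measure n p) {\<kappa> \<in> space (retention_measure n p). E \<kappa>}) ^ (n ^ CARD('d))"
proof -
  let ?R = "retention_measure n p" and ?C = "mesh_index n 1 :: (nat ^ 'd) set"
  let ?X = "\<lambda>c \<kappa>. \<kappa> (1, c) \<and> E (subtree n c \<kappa>)"
  interpret prob_space ?R
    by (rule prob_space_retention_measure)
  have "{\<kappa> \<in> space ?R. \<not> some_child n E \<kappa>} = (\<Inter>c\<in>?C. ?X c -` {False} \<inter> space ?R)"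
    using mesh_index_ne[OF \<open>n > 0\<close>, of 1] by (auto simp: some_child_def)
  also have "prob \<dots> = (\<Prod>c\<in>?C. prob (?X c -` {False} \<inter> space ?R))"
    by (rule indep_varsD_finite[OF indep_child_events[OF E] mesh_index_ne[OF \<open>n > 0\<close>] finite_mesh_index])
       simp
  also have "\<dots> = (\<Prod>c\<in>?C. 1 - p * prob {\<kappa> \<in> space ?R. E \<kappa>})"
  proof (rule prod.cong[OF refl])
    fix c assume c: "c \<in> ?C"
    have "?X c -` {False} \<inter> space ?R = {\<kappa> \<in> space ?R. \<not> ?X c \<kappa>}"
      by auto
    also have "prob \<dots> = 1 - prob {\<kappa> \<in> space ?R. ?X c \<kappa>}"
      using pred_child_event[OF E c] by (intro prob_neg) (simp only: pred_def)
    finally show "prob (?X c -` {False} \<inter> space ?R) = 1 - p * prob {\<kappa> \<in> space ?R. E \<kappa>}"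
      by (simp only: prob_child_event[OF assms(2,3) E c])
  qed
  finally have "prob {\<kappa> \<in> space ?R. \<not> some_child n E \<kappa>} = (1 - p * prob {\<kappa> \<in> space ?R. E \<kappa>}) ^ (n ^ CARD('d))"
    by (simp add: card_mesh_index)
  moreover have "prob {\<kappa> \<in> space ?R. \<not> some_child n E \<kappa>} = 1 - prob {\<kappa> \<in> space ?R. some_child n E \<kappa>}"
    using pred_some_child[OF E] by (intro prob_neg) (simp only: pred_def)
  ultimately show ?thesis
    by simp
qed

section \<open>Coarse grids occur almost surely on survival\<close>

lemma pred_survivors_ne:
  assumes "n > 0"
  shows "Measurable.pred (retention_measure n p) (\<lambda>\<kappa>. survivors n \<kappa> k \<noteq> {})"
  unfolding survivors_ne_iff_funpow[OF assms] by (intro pred_funpow pred_some_child) simp_all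

lemma pred_limit_set_ne:
  assumes "n > 0"
  shows "Measurable.pred (retention_measure n p) (\<lambda>\<kappa>. limit_set n \<kappa> \<noteq> {})"
  unfolding limit_set_ne_iff[OF assms] by (intro pred_intros_countable pred_survivors_ne assms)

text \<open>
  The probabilities of reaching level \<open>k\<close> are the iterates of \<open>x \<mapsto> 1 - (1 - p * x) ^ N\<close> started at 1.
  They decrease to \<open>s\<close>, which is therefore a fixed point, and stay above the \<open>c\<close> of
  \<open>supercritical_subsolution\<close>.
\<close>
lemma survival_probability:
  fixes n :: nat and p :: real
  assumes "n > 0" "0 < p" "p \<le> 1" "1 < p * real (n ^ CARD('d::finite))"
  defines "s \<equiv> measure (retention_measure n p) {\<kappa> \<in> space (retention_measure n p).
                 limit_set n (\<kappa> :: nat \<times> (nat ^ 'd) \<Rightarrow> bool) \<noteq> {}}"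
  shows "0 < s" "s = 1 - (1 - p * s) ^ (n ^ CARD('d))"
proof -
  let ?R = "retention_measure n p :: (nat \<times> (nat ^ 'd) \<Rightarrow> bool) measure" and ?N = "n ^ CARD('d)"
  interpret prob_space ?R
    by (rule prob_space_retention_measure)
  define A where "A k = {\<kappa> \<in> space ?R. survivors n \<kappa> k \<noteq> {}}" for k
  have A_sets: "A k \<in> sets ?R" for k
    using pred_survivors_ne[OF assms(1)] by (simp add: A_def pred_def)
  have A_0: "prob (A 0) = 1"
    by (simp add: A_def prob_space)
  have A_Suc: "prob (A (Suc k)) = 1 - (1 - p * prob (A k)) ^ ?N" for k
    using prob_some_child[OF assms(1) _ assms(3) pred_survivors_ne[OF assms(1)], of k] assms(1,2)
    by (simp add: A_def survivors_ne_Suc_iff[OF assms(1)])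
  have "A (Suc k) \<subseteq> A k" for k
    by (auto simp: A_def survivors_Suc)
  then have "(\<lambda>k. prob (A k)) \<longlonglongrightarrow> prob (\<Inter>k. A k)"
    using A_sets by (intro finite_Lim_measure_decseq decseq_SucI) auto
  moreover have "(\<Inter>k. A k) = {\<kappa> \<in> space ?R. limit_set n \<kappa> \<noteq> {}}"
    by (auto simp: A_def limit_set_ne_iff[OF assms(1)])
  ultimately have lim: "(\<lambda>k. prob (A k)) \<longlonglongrightarrow> s"
    by (simp add: s_def)
  have "(\<lambda>k. prob (A (Suc k))) \<longlonglongrightarrow> 1 - (1 - p * s) ^ ?N"
    unfolding A_Suc by (intro tendsto_intros lim)
  moreover have "(\<lambda>k. prob (A (Suc k))) \<longlonglongrightarrow> s"
    by (rule LIMSEQ_Suc[OF lim])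
  ultimately show "s = 1 - (1 - p * s) ^ ?N"
    using LIMSEQ_unique by blast
  obtain c where c: "0 < c" "c \<le> 1" "c \<le> 1 - (1 - p * c) ^ ?N"
    using supercritical_subsolution[OF assms(2-4)] .
  have "c \<le> prob (A k)" for k
  proof (induction k)
    case 0
    then show ?case
      using A_0 c by simp
  next
    case (Suc k)
    have "p * prob (A k) \<le> 1"
      using assms mult_mono[of p 1 "prob (A k)" 1] by simp
    then have "(1 - p * prob (A k)) ^ ?N \<le> (1 - p * c) ^ ?N"
      using Suc assms by (intro power_mono) auto
    then show ?case
      using c A_Suc[of k] by simp
  qed
  then have "c \<le> s"
    by (intro LIMSEQ_le_const[OF lim]) auto
  then show "0 < s"
    using c by simp
qed

lemma coarse_grid_ne: "coarse_grid T S \<Longrightarrow> T > 0 \<Longrightarrow> S \<noteq> {}"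
  unfolding coarse_grid_def by (metis emptyE zero_index)

text \<open>
  The events of being rich and of surviving are nested, and comparing their two fixed-point relations
  shows that they have the same probability.
\<close>
lemma AE_coarse_grid:
  fixes n :: nat and p :: real
  assumes "n \<ge> 2" "0 < p" "p \<le> 1" "1 < p * real (n ^ CARD('d::finite))"
  shows "AE \<kappa> in retention_measure n p.
           limit_set n (\<kappa> :: nat \<times> (nat ^ 'd) \<Rightarrow> bool) \<noteq> {} \<longrightarrow> coarse_grid T (limit_set n \<kappa>)"
proof -
  let ?R = "retention_measure n p :: (nat \<times> (nat ^ 'd) \<Rightarrow> bool) measure" and ?N = "n ^ CARD('d)"
  interpret prob_space ?R
    by (rule prob_space_retention_measure)
  have "n > 0"
    using assms(1) by simp
  obtain l where "T < 2 ^ l"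
    using less_exp by blast
  also have "\<dots> \<le> n ^ l"
    using assms(1) by (rule power_mono) simp
  finally have l: "T \<le> n ^ l" "1 \<le> n ^ l"
    using \<open>n > 0\<close> by simp_all
  \<comment> \<open>\<open>rich\<close>: some cube, \<open>m\<close> retained generations down, has all its descendants of relative level \<open>l\<close> alive.\<close>
  define alive where "alive = (\<lambda>\<kappa> :: nat \<times> (nat ^ 'd) \<Rightarrow> bool. limit_set n \<kappa> \<noteq> {})"
  define full where "full k = (every_child n ^^ k) alive" for k
  define rich where "rich \<kappa> \<longleftrightarrow> (\<exists>m. (some_child n ^^ m) (full l) \<kappa>)" for \<kappa>
  have alive: "Measurable.pred ?R alive"
    unfolding alive_def by (rule pred_limit_set_ne[OF \<open>n > 0\<close>])
  have full: "Measurable.pred ?R (full k)" for k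
    unfolding full_def by (intro pred_funpow pred_every_child alive)
  have rich: "Measurable.pred ?R rich"
    unfolding rich_def by (intro pred_intros_countable pred_funpow pred_some_child full)
  define s where "s = prob {\<kappa> \<in> space ?R. alive \<kappa>}"
  define g where "g = prob {\<kappa> \<in> space ?R. rich \<kappa>}"
  have s: "0 < s" "s = 1 - (1 - p * s) ^ ?N"
    unfolding s_def alive_def by (rule survival_probability[OF \<open>n > 0\<close> assms(2-4)])+
  have rich_grid: "coarse_grid U (limit_set n \<kappa>)" if "rich \<kappa>" "U \<le> n ^ l" for \<kappa> U
  proof -
    obtain m where "(some_child n ^^ m) (full l) \<kappa>"
      using \<open>rich \<kappa>\<close> by (auto simp: rich_def)
    then show ?thesis
      by (rule some_child_imp_coarse_grid[OF \<open>n > 0\<close>])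
         (auto simp: full_def alive_def intro: every_child_imp_coarse_grid[OF \<open>n > 0\<close> _ that(2)])
  qed
  \<comment> \<open>A \<open>1 \<times> \<dots> \<times> 1\<close> grid met by a set is enough for the set to be non-empty.\<close>
  have rich_alive: "{\<kappa> \<in> space ?R. rich \<kappa>} \<subseteq> {\<kappa> \<in> space ?R. alive \<kappa>}"
    using coarse_grid_ne[OF rich_grid[OF _ l(2)]] by (auto simp: alive_def)
  have "g \<le> s"
    unfolding g_def s_def using rich_alive alive by (intro finite_measure_mono) (auto simp: pred_def)
  have "0 < prob {\<kappa> \<in> space ?R. full k \<kappa>}" for k
  proof (induction k)
    case 0
    then show ?case
      using s by (simp add: full_def s_def)
  next
    case (Suc k)
    then show ?case
      using prob_every_child[OF \<open>n > 0\<close> _ assms(3) full[of k]] assms(2) by (simp add: full_def)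
  qed
  also have "prob {\<kappa> \<in> space ?R. full l \<kappa>} \<le> g"
    unfolding g_def using rich
    by (intro finite_measure_mono) (auto simp: pred_def rich_def intro: exI[of _ 0])
  finally have "0 < g" .
  have "rich \<kappa>" if child: "some_child n rich \<kappa>" for \<kappa>
  proof -
    obtain c m where "c \<in> mesh_index n 1" "\<kappa> (1, c)" "(some_child n ^^ m) (full l) (subtree n c \<kappa>)"
      using child unfolding some_child_def[of n rich] rich_def by blast
    then have "(some_child n ^^ Suc m) (full l) \<kappa>"
      by (auto simp: some_child_def[of n _ \<kappa>])
    then show ?thesis
      unfolding rich_def by blast
  qed
  then have "prob {\<kappa> \<in> space ?R. some_child n rich \<kappa>} \<le> g"
    unfolding g_def using rich by (intro finite_measure_mono) (auto simp: pred_def)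
  then have "1 - (1 - p * g) ^ ?N \<le> g"
    using prob_some_child[OF \<open>n > 0\<close> _ assms(3) rich] assms(2) by (simp add: g_def)
  moreover have "2 \<le> ?N"
    using assms(1) self_le_power[of n "CARD('d)"] by simp
  ultimately have "g = s"
    using s \<open>0 < g\<close> \<open>g \<le> s\<close> assms(2,3)
    by (intro survival_fixed_point_unique[of p ?N]) (auto simp: s_def)
  have "prob ({\<kappa> \<in> space ?R. alive \<kappa>} - {\<kappa> \<in> space ?R. rich \<kappa>}) = s - g"
    unfolding s_def g_def using alive rich rich_alive
    by (intro finite_measure_Diff) (auto simp: pred_def)
  then have "prob ({\<kappa> \<in> space ?R. alive \<kappa>} - {\<kappa> \<in> space ?R. rich \<kappa>}) = 0"
    using \<open>g = s\<close> by simp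
  then have "AE \<kappa> in ?R. \<kappa> \<notin> {\<kappa> \<in> space ?R. alive \<kappa>} - {\<kappa> \<in> space ?R. rich \<kappa>}"
    using alive rich by (subst prob_eq_0[symmetric]) (auto simp: pred_def)
  then show ?thesis
    by (rule AE_mp) (use rich_grid[OF _ l(1)] in \<open>auto simp: alive_def\<close>)
qed

text \<open>
  Independence and the retention probability determine the joint law, so almost sure statements about
  the canonical patterns hold for every percolation.
\<close>
lemma (in fractal_percolation) distr_keep:
  assumes "n > 0" "0 \<le> p" "p \<le> 1"
  shows "distr M (retention_measure n p) (\<lambda>\<omega>. \<lambda>a\<in>mesh_addresses n. keep a \<omega>) = retention_measure n p"
proof -
  let ?I = "mesh_addresses n :: (nat \<times> (nat ^ 'b)) set"
  have rv: "random_variable (count_space UNIV) (keep a)" if "a \<in> ?I" for a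
    using indep_keep that unfolding indep_vars_def mesh_addresses_def by blast
  have "?I \<noteq> {}"
    using first_generation_addresses mesh_index_ne[OF assms(1), of 1] by blast
  have "distr M (count_space UNIV) (keep a) = measure_pmf (bernoulli_pmf p)" if "a \<in> ?I" for a
  proof (rule measure_eqI_countable[of _ UNIV])
    fix b
    interpret D: prob_space "distr M (count_space UNIV) (keep a)"
      by (rule prob_space_distr[OF rv[OF that]])
    have T: "prob {\<omega> \<in> space M. keep a \<omega>} = p"
      using prob_keep[of "fst a" "snd a"] that by (auto simp: mesh_addresses_def)
    have F: "prob {\<omega> \<in> space M. \<not> keep a \<omega>} = 1 - p"
      using T rv[OF that] by (subst prob_neg) (auto simp: pred_def)
    have "measure (distr M (count_space UNIV) (keep a)) {b} = prob {\<omega> \<in> space M. keep a \<omega> = b}"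
      using measure_distr[OF rv[OF that], of "{b}"] by (simp add: vimage_def Int_def conj_commute)
    also have "\<dots> = pmf (bernoulli_pmf p) b"
      using T F assms by (cases b) simp_all
    finally show "emeasure (distr M (count_space UNIV) (keep a)) {b} = emeasure (measure_pmf (bernoulli_pmf p)) {b}"
      by (simp add: D.emeasure_eq_measure emeasure_pmf_single)
  qed auto
  then have "(\<Pi>\<^sub>M a\<in>?I. distr M (count_space UNIV) (keep a)) = retention_measure n p"
    unfolding retention_measure_def by (intro PiM_cong) auto
  moreover have "distr M (PiM ?I (\<lambda>_. count_space UNIV)) (\<lambda>\<omega>. \<lambda>a\<in>?I. keep a \<omega>)
      = (\<Pi>\<^sub>M a\<in>?I. distr M (count_space UNIV) (keep a))"
    using indep_keep by (subst indep_vars_iff_distr_eq_PiM'[OF \<open>?I \<noteq> {}\<close>, symmetric])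
      (auto simp: mesh_addresses_def intro!: rv[unfolded mesh_addresses_def])
  moreover have "distr M (retention_measure n p) (\<lambda>\<omega>. \<lambda>a\<in>?I. keep a \<omega>)
      = distr M (PiM ?I (\<lambda>_. count_space UNIV)) (\<lambda>\<omega>. \<lambda>a\<in>?I. keep a \<omega>)"
    by (intro distr_cong) (auto simp: sets_retention_measure)
  ultimately show ?thesis
    by simp
qed

theorem corollary5p2:
  fixes M :: "'w measure" and d n :: nat and p :: real
    and keep :: "nat \<times> (nat ^ 'd::finite) \<Rightarrow> 'w \<Rightarrow> bool"
  assumes "CARD('d) = d" and "d \<ge> 1" and "n \<ge> 2"
    and "0 < p" and "p < 1" and "p > 1 / real n ^ d"
    and "fractal_percolation M n p keep"
  shows "AE \<omega> in uniform_measure M {\<omega> \<in> space M. percolation_set n keep \<omega> \<noteq> {}}.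
           \<not> (\<exists>\<phi>. bi_lipschitz_into (d - 1) (percolation_set n keep \<omega>) \<phi>)"
proof -
  interpret fractal_percolation M n p keep
    by fact
  let ?R = "retention_measure n p :: (nat \<times> (nat ^ 'd) \<Rightarrow> bool) measure"
  let ?\<kappa> = "\<lambda>\<omega>. \<lambda>a\<in>mesh_addresses n. keep a \<omega>"
  have "n > 0"
    using assms(3) by simp
  have supercritical: "1 < p * real (n ^ CARD('d))"
    using assms(1,6) \<open>n > 0\<close> by (simp add: field_simps)
  have "random_variable (count_space UNIV) (keep a)" if "a \<in> mesh_addresses n" for a
    using indep_keep that unfolding indep_vars_def mesh_addresses_def by blast
  then have meas: "?\<kappa> \<in> measurable M ?R"
    unfolding retention_measure_def by (intro measurable_restrict) simp
  have "AE \<kappa> in ?R. \<forall>T. limit_set n \<kappa> \<noteq> {} \<longrightarrow> coarse_grid T (limit_set n \<kappa>)"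
    unfolding AE_all_countable
    by (intro allI AE_coarse_grid assms(3,4) supercritical) (use assms(5) in simp)
  then have "AE \<kappa> in distr M ?R ?\<kappa>. \<forall>T. limit_set n \<kappa> \<noteq> {} \<longrightarrow> coarse_grid T (limit_set n \<kappa>)"
    by (subst distr_keep[OF \<open>n > 0\<close> less_imp_le[OF assms(4)] less_imp_le[OF assms(5)]])
  then have "AE \<omega> in M. \<forall>T. percolation_set n keep \<omega> \<noteq> {} \<longrightarrow> coarse_grid T (percolation_set n keep \<omega>)"
    unfolding percolation_set_eq_limit_set by (rule AE_distrD[OF meas])
  then have "AE \<omega> in M. \<omega> \<in> {\<omega> \<in> space M. percolation_set n keep \<omega> \<noteq> {}} \<longrightarrow>
      \<not> (\<exists>\<phi>. bi_lipschitz_into (d - 1) (percolation_set n keep \<omega>) \<phi>)"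
    by (rule eventually_mono) (use coarse_grids_imp_no_bi_lipschitz[where ?'d = 'd] assms(1) in auto)
  moreover have "{\<omega> \<in> space M. percolation_set n keep \<omega> \<noteq> {}} \<in> sets M"
    unfolding percolation_set_eq_limit_set
    using measurable_compose[OF meas pred_limit_set_ne[OF \<open>n > 0\<close>]] by (simp add: pred_def)
  ultimately show ?thesis
    by (intro AE_uniform_measureI)
qed

end
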